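(* Let $\Phi : \mathbb{R} \to \mathbb{R}$ be a continuous positive integrable function on $\mathbb{R}$ such that $\Phi(0) = 1$. Let $\gamma > 0$ and let $X_\gamma \sim \mathcal{N}(0,\gamma^2)$ be a centred Gaussian random variable with variance $\gamma^2$. Define (the law of) the random variable $\mathcal{H}_\gamma(\Phi)$ by $$\mathbb{E}\big( f(\mathcal{H}_\gamma(\Phi)) \big) := \frac{\mathbb{E}\big( f(X_\gamma)\, \Phi( X_\gamma/\gamma^2 ) \big)}{\mathbb{E}\big( \Phi( X_\gamma/\gamma^2 ) \big)}$$ for all bounded measurable $f : \mathbb{R} \to \mathbb{R}$. Then, for all $u \in \mathbb{R}$, $$\frac{\mathbb{E}\big( e^{u \mathcal{H}_\gamma(\Phi)} \big)}{\mathbb{E}\big( e^{u X_\gamma} \big)} = \frac{\mathbb{E}\big( \Phi( \tfrac{X_\gamma}{\gamma^2} + u ) \big)}{\mathbb{E}\big( \Phi( \tfrac{X_\gamma}{\gamma^2} ) \big)},$$ and in particular, locally uniformly in $u \in \mathbb{R}$, $$\frac{\mathbb{E}\big( e^{u \mathcal{H}_\gamma(\Phi)} \big)}{\mathbb{E}\big( e^{u X_\gamma} \big)} \longrightarrow \Phi(u) \qquad \text{as } \gamma \to +\infty .$$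
   Context: Integrable means integrable with respect to Lebesgue measure on $\mathbb{R}$. *)

theory Defs
  imports "HOL-Probability.Probability"
begin

text \<open>
  \<open>penalised \<Phi> \<gamma> M X N H\<close>: the random variable \<open>H\<close> on the probability space \<open>N\<close> has the law of
  \<open>\<H>\<^sub>\<gamma>(\<Phi>)\<close>, the variable \<open>X\<close> on \<open>M\<close> playing the role of \<open>X\<^sub>\<gamma>\<close>.
  Only the law of \<open>H\<close> is constrained, so \<open>H\<close> may live on a space other than that of \<open>X\<close>.
\<close>

definition penalised ::
  "(real \<Rightarrow> real) \<Rightarrow> real \<Rightarrow> 'a measure \<Rightarrow> ('a \<Rightarrow> real) \<Rightarrow> 'b measure \<Rightarrow> ('b \<Rightarrow> real) \<Rightarrow> bool" where
  "penalised \<Phi> \<gamma> M X N H \<longleftrightarrow>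
     prob_space N \<and> H \<in> borel_measurable N \<and>
     (\<forall>f :: real \<Rightarrow> real. f \<in> borel_measurable borel \<longrightarrow> bounded (range f) \<longrightarrow>
        (\<integral>\<omega>. f (H \<omega>) \<partial>N) =
        (\<integral>\<omega>. f (X \<omega>) * \<Phi> (X \<omega> / \<gamma>\<^sup>2) \<partial>M) / (\<integral>\<omega>. \<Phi> (X \<omega> / \<gamma>\<^sup>2) \<partial>M))"

text \<open>Under the standing assumptions on \<open>\<Phi>\<close> such an \<open>H\<close> exists, on a reweighting of \<open>M\<close>.\<close>

lemma penalised_exists:
  fixes \<Phi> :: "real \<Rightarrow> real" and X :: "'a \<Rightarrow> real"
  assumes cont: "continuous_on UNIV \<Phi>" and pos: "\<And>x. \<Phi> x > 0" and int: "integrable lborel \<Phi>"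
    and \<gamma>: "\<gamma> > 0" and M: "prob_space M"
    and X: "distributed M lborel X (normal_density 0 \<gamma>)"
  shows "\<exists>(N :: 'a measure) H. penalised \<Phi> \<gamma> M X N H"
proof -
  interpret M: prob_space M by (rule M)
  have X_meas [measurable]: "X \<in> borel_measurable M"
    using distributed_measurable[OF X] by simp
  have \<Phi>_meas [measurable]: "\<Phi> \<in> borel_measurable borel"
    by (rule borel_measurable_continuous_onI[OF cont])
  define w where "w = (\<lambda>\<omega>. \<Phi> (X \<omega> / \<gamma>\<^sup>2))"
  have w_meas [measurable]: "w \<in> borel_measurable M" unfolding w_def by measurable
  have "integrable lborel (\<lambda>x. \<Phi> (0 + (1 / \<gamma>\<^sup>2) * x))"
    using \<gamma> int by (intro lborel_integrable_real_affine) auto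
  then have int': "integrable lborel (\<lambda>x. \<Phi> (x / \<gamma>\<^sup>2))" by simp
  have bound: "norm (normal_density 0 \<gamma> x * \<Phi> (x / \<gamma>\<^sup>2))
      \<le> norm (1 / sqrt (2 * pi * \<gamma>\<^sup>2) * \<Phi> (x / \<gamma>\<^sup>2))" for x
    using pos[of "x / \<gamma>\<^sup>2"]
    by (auto simp: normal_density_def abs_mult intro!: divide_right_mono mult_left_le_one_le)
  have "integrable lborel (\<lambda>x. normal_density 0 \<gamma> x * \<Phi> (x / \<gamma>\<^sup>2))"
    by (rule Bochner_Integration.integrable_bound
          [OF integrable_mult_right[OF int', of "1 / sqrt (2 * pi * \<gamma>\<^sup>2)"]])
       (use bound in auto)
  then have w_int: "integrable M w"
    using distributed_integrable[OF X, of "\<lambda>x. \<Phi> (x / \<gamma>\<^sup>2)"] by (simp add: w_def)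
  define Z where "Z = (\<integral>\<omega>. w \<omega> \<partial>M)"
  have w_pos: "w \<omega> > 0" for \<omega> by (simp add: w_def pos)
  have Z: "Z > 0"
  proof -
    have "Z \<ge> 0" unfolding Z_def using w_pos by (intro integral_nonneg_AE) (auto intro: less_imp_le)
    moreover have "Z \<noteq> 0"
    proof
      assume "Z = 0"
      then have "AE \<omega> in M. w \<omega> = 0"
        using integral_nonneg_eq_0_iff_AE[OF w_int] w_pos unfolding Z_def
        by (auto intro: less_imp_le)
      then have "AE \<omega> in M. False" using w_pos by (auto simp: less_le)
      then show False by simp
    qed
    ultimately show ?thesis by simp
  qed
  define N where "N = density M (\<lambda>\<omega>. ennreal (w \<omega> / Z))"
  have wZ: "0 \<le> w \<omega> / Z" for \<omega> using w_pos[of \<omega>] Z by simp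
  have "emeasure N (space N) = (\<integral>\<^sup>+\<omega>. ennreal (w \<omega> / Z) \<partial>M)"
    unfolding N_def by (simp add: emeasure_density cong: nn_integral_cong)
  also have "\<dots> = ennreal (\<integral>\<omega>. w \<omega> / Z \<partial>M)"
    using w_int wZ by (intro nn_integral_eq_integral) auto
  also have "\<dots> = 1" using Z by (simp add: Z_def)
  finally have N: "prob_space N" by (rule prob_spaceI)
  have "(\<integral>\<omega>. f (X \<omega>) \<partial>N) = (\<integral>\<omega>. f (X \<omega>) * w \<omega> \<partial>M) / Z"
    if [measurable]: "f \<in> borel_measurable borel" for f :: "real \<Rightarrow> real"
  proof -
    have "(\<integral>\<omega>. f (X \<omega>) \<partial>N) = (\<integral>\<omega>. (w \<omega> / Z) *\<^sub>R f (X \<omega>) \<partial>M)"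
      unfolding N_def using wZ by (intro integral_density) auto
    also have "\<dots> = (\<integral>\<omega>. (f (X \<omega>) * w \<omega>) / Z \<partial>M)"
      by (intro Bochner_Integration.integral_cong) (auto simp: mult.commute)
    finally show ?thesis by simp
  qed
  moreover have "X \<in> borel_measurable N" by (simp add: N_def)
  ultimately have "penalised \<Phi> \<gamma> M X N X"
    using N unfolding penalised_def Z_def w_def by blast
  then show ?thesis by blast
qed

end

theory Submission imports Defs "HOL-Real_Asymp.Real_Asymp" begin

text \<open>
  Completing the square, weighting by \<open>exp (u * X)\<close> shifts the mean of the Gaussian \<open>X\<close> by
  \<open>u * \<gamma>\<^sup>2\<close>, hence shifts \<open>X / \<gamma>\<^sup>2\<close> by \<open>u\<close>; this is the identity. Since \<open>X / \<gamma>\<^sup>2 + u\<close> is Gaussian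
  with mean \<open>u\<close> and standard deviation \<open>1 / \<gamma>\<close>, the right-hand side is a quotient of Gaussian
  smoothings of \<open>\<Phi>\<close>. They converge locally uniformly although \<open>\<Phi>\<close> may be unbounded: away
  from \<open>u\<close> the Gaussian density is uniformly small, so integrability of \<open>\<Phi>\<close> controls the tails.
\<close>

section \<open>Bounds and exponential tilting for Gaussian densities\<close>

lemma normal_density_le:
  "normal_density \<mu> \<sigma> x \<le> 1 / sqrt (2 * pi * \<sigma>\<^sup>2)"
  by (auto simp: normal_density_def intro!: divide_right_mono)

lemma normal_density_le_far:
  assumes "0 \<le> \<delta>" "\<delta> \<le> \<bar>x - \<mu>\<bar>"
  shows "normal_density \<mu> \<sigma> x \<le> normal_density 0 \<sigma> \<delta>"
proof -
  have "\<delta>\<^sup>2 \<le> (x - \<mu>)\<^sup>2"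
    using assms by (metis abs_le_square_iff abs_of_nonneg)
  then show ?thesis
    by (auto simp: normal_density_def intro!: mult_left_mono divide_right_mono)
qed

text \<open>The density is bounded by its peak value, so a multiple of \<open>f\<close> itself
  dominates the product. This replaces boundedness of \<open>f\<close>.\<close>

lemma integrable_normal_density_mult:
  assumes "integrable lborel f"
  shows "integrable lborel (\<lambda>x. normal_density \<mu> \<sigma> x * f x)"
proof (rule Bochner_Integration.integrable_bound)
  show "integrable lborel (\<lambda>x. 1 / sqrt (2 * pi * \<sigma>\<^sup>2) * f x)"
    using assms by (rule integrable_mult_right)
  have [measurable]: "f \<in> borel_measurable borel"
    using assms by simp
  show "(\<lambda>x. normal_density \<mu> \<sigma> x * f x) \<in> borel_measurable lborel" by measurable
  have "\<bar>normal_density \<mu> \<sigma> x * f x\<bar> \<le> \<bar>1 / sqrt (2 * pi * \<sigma>\<^sup>2) * f x\<bar>" for x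
    unfolding abs_mult using normal_density_le[of \<mu> \<sigma> x]
    by (intro mult_right_mono) auto
  then show "AE x in lborel. norm (normal_density \<mu> \<sigma> x * f x) \<le> norm (1 / sqrt (2 * pi * \<sigma>\<^sup>2) * f x)"
    by auto
qed

text \<open>Completing the square in the exponent. The constant factor is the moment generating
  function of the centred Gaussian at \<open>u\<close>, which later cancels in the quotient.\<close>

lemma exp_mult_normal_density:
  assumes "\<sigma> > 0"
  shows "normal_density 0 \<sigma> x * exp (u * x) = exp (u\<^sup>2 * \<sigma>\<^sup>2 / 2) * normal_density (u * \<sigma>\<^sup>2) \<sigma> x"
proof -
  have "- x\<^sup>2 / (2 * \<sigma>\<^sup>2) + u * x = u\<^sup>2 * \<sigma>\<^sup>2 / 2 + - (x - u * \<sigma>\<^sup>2)\<^sup>2 / (2 * \<sigma>\<^sup>2)"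
    using assms by (simp add: field_simps power2_eq_square)
  then have "exp (- x\<^sup>2 / (2 * \<sigma>\<^sup>2)) * exp (u * x)
      = exp (u\<^sup>2 * \<sigma>\<^sup>2 / 2) * exp (- (x - u * \<sigma>\<^sup>2)\<^sup>2 / (2 * \<sigma>\<^sup>2))"
    unfolding exp_add[symmetric] by simp
  then show ?thesis by (simp add: normal_density_def)
qed

section \<open>Locally uniform convergence of Gaussian smoothings\<close>

text \<open>Split at distance \<delta> from \<open>u\<close>. Nearby, the oscillation of \<Phi>
  costs \<epsilon>. Far away, \<open>\<Phi> y\<close> is weighted by at most the density height at
  \<delta>, which leaves the total integral of \<Phi>, and the constant \<open>\<Phi> u\<close>
  meets the Gaussian tail mass, bounded by Chebyshev.\<close>

lemma normal_smoothing_error: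
  fixes \<Phi> :: "real \<Rightarrow> real"
  assumes int: "integrable lborel \<Phi>" and nonneg: "\<And>x. \<Phi> x \<ge> 0"
    and s: "s > 0" and \<delta>: "\<delta> > 0" and \<epsilon>: "\<epsilon> \<ge> 0"
    and near: "\<And>y. \<bar>y - u\<bar> < \<delta> \<Longrightarrow> \<bar>\<Phi> y - \<Phi> u\<bar> \<le> \<epsilon>"
  shows "\<bar>(\<integral>y. normal_density u s y * \<Phi> y \<partial>lborel) - \<Phi> u\<bar>
    \<le> \<epsilon> + normal_density 0 s \<delta> * (\<integral>y. \<Phi> y \<partial>lborel) + \<Phi> u * (s\<^sup>2 / \<delta>\<^sup>2)"
proof -
  let ?n = "normal_density u s"
  \<comment> \<open>The even-moment formula with \<open>k = 1\<close> is the variance: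
    \<open>fact 2 / (2 / s^2) = s^2\<close>.\<close>
  have var: "has_bochner_integral lborel (\<lambda>y. ?n y * (y - u)\<^sup>2) (s\<^sup>2)"
    using normal_moment_even[OF s, of u 1] by (simp add: fact_numeral)
  have int_n\<Phi>: "integrable lborel (\<lambda>y. ?n y * \<Phi> y)"
    by (rule integrable_normal_density_mult[OF int])
  have [simp]: "integrable lborel ?n" "(\<integral>y. ?n y \<partial>lborel) = 1" using s by auto
  have var_int [simp]: "integrable lborel (\<lambda>y. ?n y * (y - u)\<^sup>2)"
    and [simp]: "(\<integral>y. ?n y * (y - u)\<^sup>2 \<partial>lborel) = s\<^sup>2"
    using var by (auto simp: has_bochner_integral_iff)
  \<comment> \<open>All three summands are nonnegative, so a single integrable majorant covers both
    the near and the far region.\<close>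
  have ptwise: "\<bar>?n y * \<Phi> y - ?n y * \<Phi> u\<bar>
    \<le> ?n y * \<epsilon> + normal_density 0 s \<delta> * \<Phi> y + (\<Phi> u / \<delta>\<^sup>2) * (?n y * (y - u)\<^sup>2)" for y
  proof (cases "\<bar>y - u\<bar> < \<delta>")
    case True
    have "\<bar>?n y * \<Phi> y - ?n y * \<Phi> u\<bar> = ?n y * \<bar>\<Phi> y - \<Phi> u\<bar>"
      by (simp add: abs_mult flip: right_diff_distrib)
    also have "\<dots> \<le> ?n y * \<epsilon>"
      using near[OF True] by (intro mult_left_mono) auto
    also have "\<dots> \<le> ?n y * \<epsilon> + (normal_density 0 s \<delta> * \<Phi> y + (\<Phi> u / \<delta>\<^sup>2) * (?n y * (y - u)\<^sup>2))"
      using nonneg by (simp add: add_nonneg_nonneg)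
    finally show ?thesis by simp
  next
    case False
    have "?n y * \<Phi> y \<le> normal_density 0 s \<delta> * \<Phi> y"
      using normal_density_le_far[of \<delta> y u s] \<delta> False nonneg by (intro mult_right_mono) auto
    moreover have "?n y * \<Phi> u \<le> (\<Phi> u / \<delta>\<^sup>2) * (?n y * (y - u)\<^sup>2)"
    proof -
      have "\<delta>\<^sup>2 \<le> (y - u)\<^sup>2"
        using \<delta> False by (metis abs_le_square_iff abs_of_pos linorder_not_less)
      \<comment> \<open>Chebyshev's inequality in pointwise form: on the far region the constant 1
        is dominated by the scaled squared deviation.\<close>
      then have "1 \<le> (y - u)\<^sup>2 / \<delta>\<^sup>2" using \<delta> by simp
      then have "?n y * \<Phi> u * 1 \<le> ?n y * \<Phi> u * ((y - u)\<^sup>2 / \<delta>\<^sup>2)"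
        using nonneg by (intro mult_left_mono) auto
      then show ?thesis by (simp add: mult_ac)
    qed
    moreover have "0 \<le> ?n y * \<Phi> y" "0 \<le> ?n y * \<Phi> u" "0 \<le> ?n y * \<epsilon>"
      using nonneg \<epsilon> by auto
    ultimately show ?thesis by linarith
  qed
  have "(\<integral>y. ?n y * \<Phi> y \<partial>lborel) - \<Phi> u = (\<integral>y. ?n y * \<Phi> y - ?n y * \<Phi> u \<partial>lborel)"
    using int_n\<Phi> by simp
  also have "\<bar>\<dots>\<bar> \<le> (\<integral>y. \<bar>?n y * \<Phi> y - ?n y * \<Phi> u\<bar> \<partial>lborel)"
    by (rule integral_abs_bound)
  also have "\<dots> \<le> (\<integral>y. ?n y * \<epsilon> + normal_density 0 s \<delta> * \<Phi> y
      + (\<Phi> u / \<delta>\<^sup>2) * (?n y * (y - u)\<^sup>2) \<partial>lborel)"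
    using ptwise int int_n\<Phi>
    by (intro integral_mono integrable_abs Bochner_Integration.integrable_add
        Bochner_Integration.integrable_diff) auto
  also have "\<dots> = \<epsilon> + normal_density 0 s \<delta> * (\<integral>y. \<Phi> y \<partial>lborel) + \<Phi> u * (s\<^sup>2 / \<delta>\<^sup>2)"
    using int by (simp add: Bochner_Integration.integral_add)
  finally show ?thesis .
qed

text \<open>Compactness makes the error bound independent of \<open>u\<close>: uniform continuity
  gives one \<delta> and boundedness gives one \<open>C\<close> in place of \<open>\<Phi> u\<close>.
  The two remaining terms vanish as the standard deviation \<open>1 / \<gamma>\<close> tends to
  0.\<close>

lemma uniform_limit_normal_smoothing:
  fixes \<Phi> :: "real \<Rightarrow> real"
  assumes cont: "continuous_on UNIV \<Phi>" and int: "integrable lborel \<Phi>" and nonneg: "\<And>x. \<Phi> x \<ge> 0"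
  shows "uniform_limit (cball a r)
    (\<lambda>\<gamma> u. \<integral>y. normal_density u (1 / \<gamma>) y * \<Phi> y \<partial>lborel) \<Phi> at_top"
proof (rule uniform_limitI)
  fix e :: real assume e: "e > 0"
  \<comment> \<open>The radius is enlarged by 1 so that points within \<delta> of
    \<open>cball a r\<close> stay in \<open>?K\<close>; the minimum with 1 in the choice of \<delta>
    ensures this.\<close>
  let ?K = "cball a (r + 1)" and ?I = "\<integral>y. \<Phi> y \<partial>lborel"
  have cont_K: "continuous_on ?K \<Phi>" using cont by (rule continuous_on_subset) simp
  obtain C where C: "\<And>y. y \<in> ?K \<Longrightarrow> norm (\<Phi> y) \<le> C"
    using compact_imp_bounded[OF compact_continuous_image[OF cont_K compact_cball]]
    unfolding bounded_iff by blast
  have "uniformly_continuous_on ?K \<Phi>"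
    by (rule compact_uniformly_continuous[OF cont_K compact_cball])
  then obtain d where d: "d > 0"
    "\<And>x y. x \<in> ?K \<Longrightarrow> y \<in> ?K \<Longrightarrow> dist y x < d \<Longrightarrow> dist (\<Phi> y) (\<Phi> x) < e / 2"
    unfolding uniformly_continuous_on_def using e by (metis half_gt_zero)
  define \<delta> where "\<delta> = min d 1"
  have \<delta>: "\<delta> > 0" using d by (simp add: \<delta>_def)
  \<comment> \<open>At fixed \<delta> the density grows like \<gamma> through its prefactor, but the
    factor \<open>exp (- \<gamma>^2 * \<delta>^2 / 2)\<close> wins.\<close>
  have "((\<lambda>\<gamma>. normal_density 0 (1 / \<gamma>) \<delta>) \<longlongrightarrow> 0) at_top"
    unfolding normal_density_def using \<delta> by real_asymp
  moreover have "((\<lambda>\<gamma>. (1 / \<gamma>)\<^sup>2 / \<delta>\<^sup>2) \<longlongrightarrow> 0) at_top"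
    using \<delta> by real_asymp
  \<comment> \<open>The oscillation takes \<open>e / 2\<close>, leaving the other half for the
    vanishing terms. Since \<open>u\<close> does not occur, one threshold for \<gamma> serves the
    whole ball.\<close>
  ultimately have "((\<lambda>\<gamma>. e / 2 + normal_density 0 (1 / \<gamma>) \<delta> * ?I + C * ((1 / \<gamma>)\<^sup>2 / \<delta>\<^sup>2))
      \<longlongrightarrow> e / 2 + 0 * ?I + C * 0) at_top"
    by (intro tendsto_intros)
  from order_tendstoD(2)[OF this, of e]
  have "\<forall>\<^sub>F \<gamma> in at_top. e / 2 + normal_density 0 (1 / \<gamma>) \<delta> * ?I + C * ((1 / \<gamma>)\<^sup>2 / \<delta>\<^sup>2) < e"
    using e by simp
  then show "\<forall>\<^sub>F \<gamma> in at_top. \<forall>u\<in>cball a r.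
      dist (\<integral>y. normal_density u (1 / \<gamma>) y * \<Phi> y \<partial>lborel) (\<Phi> u) < e"
    using eventually_gt_at_top[of 0]
  proof eventually_elim
    case (elim \<gamma>)
    show ?case
    proof
      fix u assume u: "u \<in> cball a r"
      have "\<bar>\<Phi> y - \<Phi> u\<bar> \<le> e / 2" if "\<bar>y - u\<bar> < \<delta>" for y
      proof -
        have "y \<in> ?K" "u \<in> ?K" "dist y u < d"
          using u that unfolding mem_cball dist_real_def \<delta>_def by linarith+
        then show ?thesis using d(2)[of u y] by (simp add: dist_real_def)
      qed
      then have "\<bar>(\<integral>y. normal_density u (1 / \<gamma>) y * \<Phi> y \<partial>lborel) - \<Phi> u\<bar>
          \<le> e / 2 + normal_density 0 (1 / \<gamma>) \<delta> * ?I + \<Phi> u * ((1 / \<gamma>)\<^sup>2 / \<delta>\<^sup>2)"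
        using elim(2) e by (intro normal_smoothing_error int nonneg \<delta>) auto
      also have "\<dots> \<le> e / 2 + normal_density 0 (1 / \<gamma>) \<delta> * ?I + C * ((1 / \<gamma>)\<^sup>2 / \<delta>\<^sup>2)"
        using C[of u] u by (intro add_left_mono mult_right_mono) auto
      finally show "dist (\<integral>y. normal_density u (1 / \<gamma>) y * \<Phi> y \<partial>lborel) (\<Phi> u) < e"
        using elim(1) by (simp add: dist_real_def)
    qed
  qed
qed

section \<open>From bounded test functions to the law and to unbounded integrands\<close>

text \<open>Indicators of Borel sets are bounded test functions, so the defining identity already
  determines the law as that of \<open>X\<close> under the measure reweighted by \<Phi>.\<close>

lemma penalised_law:
  fixes \<Phi> :: "real \<Rightarrow> real"
  assumes H: "penalised \<Phi> \<gamma> M X N H" and M: "prob_space M"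
    and [measurable]: "X \<in> borel_measurable M" "\<Phi> \<in> borel_measurable borel"
    and nonneg: "\<And>x. \<Phi> x \<ge> 0" and int: "integrable M (\<lambda>\<omega>. \<Phi> (X \<omega> / \<gamma>\<^sup>2))"
  shows "distr N borel H =
    distr (density M (\<lambda>\<omega>. \<Phi> (X \<omega> / \<gamma>\<^sup>2) / (\<integral>\<omega>. \<Phi> (X \<omega> / \<gamma>\<^sup>2) \<partial>M))) borel X"
proof (rule measure_eqI)
  let ?Z = "\<integral>\<omega>. \<Phi> (X \<omega> / \<gamma>\<^sup>2) \<partial>M"
  interpret M: prob_space M by (rule M)
  interpret N: prob_space N using H by (simp add: penalised_def)
  have [measurable]: "H \<in> borel_measurable N" using H by (simp add: penalised_def)
  \<comment> \<open>Nonnegativity suffices for the manipulations below: if \<open>?Z\<close> were 0,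
    every quotient would be 0 by the convention \<open>x / 0 = 0\<close>.\<close>
  have Z: "?Z \<ge> 0" using nonneg by (intro integral_nonneg_AE) auto
  fix A assume "A \<in> sets (distr N borel H)"
  then have A [measurable]: "A \<in> sets borel" by simp
  let ?X = "\<lambda>\<omega>. indicator A (X \<omega>) * \<Phi> (X \<omega> / \<gamma>\<^sup>2)"
  have int_A: "integrable M ?X"
    using int by (rule Bochner_Integration.integrable_bound) (auto simp: indicator_def)
  have "bounded (range (indicator A :: real \<Rightarrow> real))"
    by (rule boundedI[of _ 1]) (auto simp: indicator_def)
  moreover have "(indicator A :: real \<Rightarrow> real) \<in> borel_measurable borel" by measurable
  ultimately have "(\<integral>\<omega>. indicator A (H \<omega>) \<partial>N) = (\<integral>\<omega>. ?X \<omega> \<partial>M) / ?Z"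
    using H unfolding penalised_def by blast
  also have "\<dots> = (\<integral>\<omega>. ?X \<omega> / ?Z \<partial>M)" by simp
  finally have eq: "(\<integral>\<omega>. indicator A (H \<omega>) \<partial>N) = (\<integral>\<omega>. ?X \<omega> / ?Z \<partial>M)" .
  have "emeasure (distr N borel H) A = (\<integral>\<^sup>+x. indicator A x \<partial>distr N borel H)"
    by simp
  also have "\<dots> = (\<integral>\<^sup>+\<omega>. ennreal (indicator A (H \<omega>)) \<partial>N)"
    by (subst nn_integral_distr) (auto simp: ennreal_indicator)
  also have "\<dots> = ennreal (\<integral>\<omega>. indicator A (H \<omega>) \<partial>N)"
    by (intro nn_integral_eq_integral N.integrable_const_bound[of _ 1]) (auto simp: indicator_def)
  also have "\<dots> = (\<integral>\<^sup>+\<omega>. ennreal (?X \<omega> / ?Z) \<partial>M)"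
    unfolding eq using int_A nonneg Z
    by (intro nn_integral_eq_integral[symmetric]) auto
  also have "\<dots> = (\<integral>\<^sup>+\<omega>. ennreal (\<Phi> (X \<omega> / \<gamma>\<^sup>2) / ?Z) * indicator (X -` A \<inter> space M) \<omega> \<partial>M)"
    by (intro nn_integral_cong) (auto simp: indicator_def)
  also have "\<dots> = emeasure (distr (density M (\<lambda>\<omega>. \<Phi> (X \<omega> / \<gamma>\<^sup>2) / ?Z)) borel X) A"
    by (simp add: emeasure_distr emeasure_density)
  finally show "emeasure (distr N borel H) A = \<dots>" .
qed simp

text \<open>The exponential is unbounded, so the defining identity cannot be applied to it directly.
  Passing through equality of laws transports both integrability and the value of the
  integral.\<close>

lemma penalised_expectation:
  fixes \<Phi> g :: "real \<Rightarrow> real"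
  assumes H: "penalised \<Phi> \<gamma> M X N H" and M: "prob_space M"
    and [measurable]: "X \<in> borel_measurable M" "\<Phi> \<in> borel_measurable borel" "g \<in> borel_measurable borel"
    and nonneg: "\<And>x. \<Phi> x \<ge> 0" and int: "integrable M (\<lambda>\<omega>. \<Phi> (X \<omega> / \<gamma>\<^sup>2))"
    and int_g: "integrable M (\<lambda>\<omega>. g (X \<omega>) * \<Phi> (X \<omega> / \<gamma>\<^sup>2))"
  shows "has_bochner_integral N (\<lambda>\<omega>. g (H \<omega>))
    ((\<integral>\<omega>. g (X \<omega>) * \<Phi> (X \<omega> / \<gamma>\<^sup>2) \<partial>M) / (\<integral>\<omega>. \<Phi> (X \<omega> / \<gamma>\<^sup>2) \<partial>M))"
proof -
  let ?Z = "\<integral>\<omega>. \<Phi> (X \<omega> / \<gamma>\<^sup>2) \<partial>M"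
  let ?M' = "density M (\<lambda>\<omega>. \<Phi> (X \<omega> / \<gamma>\<^sup>2) / ?Z)"
  have [measurable]: "H \<in> borel_measurable N" using H by (simp add: penalised_def)
  note law = penalised_law[OF H M assms(3,4) nonneg int]
  have "?Z \<ge> 0" using nonneg by (intro integral_nonneg_AE) auto
  then have w: "\<Phi> (X \<omega> / \<gamma>\<^sup>2) / ?Z \<ge> 0" for \<omega> using nonneg by simp
  have eq: "(\<Phi> (X \<omega> / \<gamma>\<^sup>2) / ?Z) *\<^sub>R g (X \<omega>) = g (X \<omega>) * \<Phi> (X \<omega> / \<gamma>\<^sup>2) / ?Z" for \<omega>
    by simp
  have "integrable N (\<lambda>\<omega>. g (H \<omega>)) \<longleftrightarrow> integrable (distr N borel H) g"
    by (simp add: integrable_distr_eq)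
  also have "\<dots> \<longleftrightarrow> integrable ?M' (\<lambda>\<omega>. g (X \<omega>))"
    unfolding law by (simp add: integrable_distr_eq)
  also have "\<dots> \<longleftrightarrow> integrable M (\<lambda>\<omega>. g (X \<omega>) * \<Phi> (X \<omega> / \<gamma>\<^sup>2) / ?Z)"
    using w by (subst integrable_density) (auto simp: eq simp del: real_scaleR_def)
  finally have 1: "integrable N (\<lambda>\<omega>. g (H \<omega>))" using int_g by simp
  have "(\<integral>\<omega>. g (H \<omega>) \<partial>N) = (\<integral>x. g x \<partial>distr N borel H)"
    by (simp add: integral_distr)
  also have "\<dots> = (\<integral>\<omega>. g (X \<omega>) \<partial>?M')"
    unfolding law by (simp add: integral_distr)
  also have "\<dots> = (\<integral>\<omega>. g (X \<omega>) * \<Phi> (X \<omega> / \<gamma>\<^sup>2) / ?Z \<partial>M)"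
    using w by (subst integral_density) (auto simp: eq simp del: real_scaleR_def)
  finally show ?thesis using 1 by (simp add: has_bochner_integral_iff)
qed

section \<open>Gaussian expectations and the tilted weight\<close>

context
  fixes M :: "'a measure" and X :: "'a \<Rightarrow> real" and \<gamma> :: real
  assumes M: "prob_space M" and \<gamma>: "\<gamma> > 0"
    and X: "distributed M lborel X (normal_density 0 \<gamma>)"
begin

lemma normal_mgf: "has_bochner_integral M (\<lambda>\<omega>. exp (u * X \<omega>)) (exp (u\<^sup>2 * \<gamma>\<^sup>2 / 2))"
proof -
  have "has_bochner_integral lborel (\<lambda>x. normal_density 0 \<gamma> x * exp (u * x)) (exp (u\<^sup>2 * \<gamma>\<^sup>2 / 2))"
    unfolding exp_mult_normal_density[OF \<gamma>] has_bochner_integral_iff using \<gamma> by simp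
  then show ?thesis
    using distributed_integrable[OF X, of "\<lambda>x. exp (u * x)"]
      distributed_integral[OF X, of "\<lambda>x. exp (u * x)"]
    by (simp add: has_bochner_integral_iff)
qed

text \<open>The affine image \<open>X / \<gamma>^2 + u\<close> is Gaussian with mean
  \<open>u\<close> and standard deviation \<open>1 / \<gamma>\<close>, so expectations of \<Phi>
  become the smoothings studied above; \<open>u = 0\<close> gives the normalising constant.\<close>

lemma normal_expectation_scaled:
  assumes int: "integrable lborel \<Phi>"
  shows "has_bochner_integral M (\<lambda>\<omega>. \<Phi> (X \<omega> / \<gamma>\<^sup>2 + u))
    (\<integral>y. normal_density u (1 / \<gamma>) y * \<Phi> y \<partial>lborel)"
proof -
  interpret M: prob_space M by (rule M)
  have "\<bar>1 / \<gamma>\<^sup>2\<bar> * \<gamma> = 1 / \<gamma>" using \<gamma> by (simp add: power2_eq_square)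
  with M.normal_density_affine[OF X \<gamma>, of "1 / \<gamma>\<^sup>2" u] \<gamma>
  have Y: "distributed M lborel (\<lambda>\<omega>. X \<omega> / \<gamma>\<^sup>2 + u) (normal_density u (1 / \<gamma>))"
    by (simp add: add.commute)
  have "\<Phi> \<in> borel_measurable lborel" using int by simp
  then show ?thesis
    using distributed_integrable[OF Y, of \<Phi>] distributed_integral[OF Y, of \<Phi>]
      integrable_normal_density_mult[OF int, of u "1 / \<gamma>"]
    by (simp add: has_bochner_integral_iff)
qed

text \<open>Tilting moves the mean to \<open>u * \<gamma>^2\<close>. Translating back to mean 0
  moves this shift into \<Phi>, where division by \<open>\<gamma>^2\<close> turns it into
  \<open>u\<close>.\<close>

lemma normal_tilted_expectation:
  assumes int: "integrable lborel \<Phi>"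
  shows "has_bochner_integral M (\<lambda>\<omega>. exp (u * X \<omega>) * \<Phi> (X \<omega> / \<gamma>\<^sup>2))
    (exp (u\<^sup>2 * \<gamma>\<^sup>2 / 2) * (\<integral>\<omega>. \<Phi> (X \<omega> / \<gamma>\<^sup>2 + u) \<partial>M))"
proof -
  have [measurable]: "\<Phi> \<in> borel_measurable borel" using int by simp
  have int': "integrable lborel (\<lambda>x. \<Phi> (x / \<gamma>\<^sup>2))"
    using lborel_integrable_real_affine[OF int, of "1 / \<gamma>\<^sup>2" 0] \<gamma> by simp
  have dens: "normal_density 0 \<gamma> x * (exp (u * x) * \<Phi> (x / \<gamma>\<^sup>2)) =
      exp (u\<^sup>2 * \<gamma>\<^sup>2 / 2) * (normal_density (u * \<gamma>\<^sup>2) \<gamma> x * \<Phi> (x / \<gamma>\<^sup>2))" for x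
    using exp_mult_normal_density[OF \<gamma>, of x u] by (simp add: mult.assoc[symmetric])
  \<comment> \<open>Substitute \<open>u * \<gamma>^2 + x\<close> for \<open>x\<close>; the scale
    factor \<open>c = 1\<close> leaves no Jacobian.\<close>
  have "(\<integral>x. normal_density (u * \<gamma>\<^sup>2) \<gamma> x * \<Phi> (x / \<gamma>\<^sup>2) \<partial>lborel) =
      (\<integral>x. normal_density 0 \<gamma> x * \<Phi> (x / \<gamma>\<^sup>2 + u) \<partial>lborel)"
    using \<gamma> by (subst lborel_integral_real_affine[where c = 1 and t = "u * \<gamma>\<^sup>2"])
      (auto simp: normal_density_def add_divide_distrib add.commute)
  also have "\<dots> = (\<integral>\<omega>. \<Phi> (X \<omega> / \<gamma>\<^sup>2 + u) \<partial>M)"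
    by (rule distributed_integral[OF X]) auto
  finally have "has_bochner_integral lborel
      (\<lambda>x. normal_density 0 \<gamma> x * (exp (u * x) * \<Phi> (x / \<gamma>\<^sup>2)))
      (exp (u\<^sup>2 * \<gamma>\<^sup>2 / 2) * (\<integral>\<omega>. \<Phi> (X \<omega> / \<gamma>\<^sup>2 + u) \<partial>M))"
    unfolding dens has_bochner_integral_iff
    using integrable_normal_density_mult[OF int'] by simp
  then show ?thesis
    using distributed_integrable[OF X, of "\<lambda>x. exp (u * x) * \<Phi> (x / \<gamma>\<^sup>2)"]
      distributed_integral[OF X, of "\<lambda>x. exp (u * x) * \<Phi> (x / \<gamma>\<^sup>2)"]
    by (simp add: has_bochner_integral_iff)
qed

text \<open>This is \<open>penalised_expectation\<close> for the exponential, whose weighted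
  integrability comes from the tilting computation.\<close>

lemma penalised_mgf:
  assumes int: "integrable lborel \<Phi>" and nonneg: "\<And>x. \<Phi> x \<ge> 0"
    and H: "penalised \<Phi> \<gamma> M X N H"
  shows "has_bochner_integral N (\<lambda>\<omega>. exp (u * H \<omega>))
    (exp (u\<^sup>2 * \<gamma>\<^sup>2 / 2) * (\<integral>\<omega>. \<Phi> (X \<omega> / \<gamma>\<^sup>2 + u) \<partial>M) / (\<integral>\<omega>. \<Phi> (X \<omega> / \<gamma>\<^sup>2) \<partial>M))"
proof -
  have "X \<in> borel_measurable M" using distributed_measurable[OF X] by simp
  moreover have "\<Phi> \<in> borel_measurable borel" using int by simp
  moreover have "integrable M (\<lambda>\<omega>. \<Phi> (X \<omega> / \<gamma>\<^sup>2))"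
    using normal_expectation_scaled[OF int, of 0] by (simp add: has_bochner_integral_iff)
  moreover note tilt = normal_tilted_expectation[OF int, of u, unfolded has_bochner_integral_iff]
  ultimately show ?thesis
    using penalised_expectation[OF H M, of "\<lambda>x. exp (u * x)"] nonneg by simp
qed

end

section \<open>The quotient identity and its locally uniform limit\<close>

theorem theorem1p2:
  fixes \<Phi> :: "real \<Rightarrow> real"
    and M :: "real \<Rightarrow> 'a measure" and X :: "real \<Rightarrow> 'a \<Rightarrow> real"
    and N :: "real \<Rightarrow> 'b measure" and H :: "real \<Rightarrow> 'b \<Rightarrow> real"
  assumes "continuous_on UNIV \<Phi>" and "\<And>x. \<Phi> x > 0" and "integrable lborel \<Phi>" and "\<Phi> 0 = 1"
    and "\<And>\<gamma>. \<gamma> > 0 \<Longrightarrow> prob_space (M \<gamma>)"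
    and "\<And>\<gamma>. \<gamma> > 0 \<Longrightarrow> distributed (M \<gamma>) lborel (X \<gamma>) (normal_density 0 \<gamma>)"
    and "\<And>\<gamma>. \<gamma> > 0 \<Longrightarrow> penalised \<Phi> \<gamma> (M \<gamma>) (X \<gamma>) (N \<gamma>) (H \<gamma>)"
  shows "(\<forall>\<gamma>>0. \<forall>u.
            integrable (N \<gamma>) (\<lambda>\<omega>. exp (u * H \<gamma> \<omega>)) \<and>
            integrable (M \<gamma>) (\<lambda>\<omega>. exp (u * X \<gamma> \<omega>)) \<and>
            integrable (M \<gamma>) (\<lambda>\<omega>. \<Phi> (X \<gamma> \<omega> / \<gamma>\<^sup>2 + u)) \<and>
            (\<integral>\<omega>. exp (u * H \<gamma> \<omega>) \<partial>N \<gamma>) / (\<integral>\<omega>. exp (u * X \<gamma> \<omega>) \<partial>M \<gamma>) =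
            (\<integral>\<omega>. \<Phi> (X \<gamma> \<omega> / \<gamma>\<^sup>2 + u) \<partial>M \<gamma>) / (\<integral>\<omega>. \<Phi> (X \<gamma> \<omega> / \<gamma>\<^sup>2) \<partial>M \<gamma>))
       \<and> (\<forall>u\<^sub>0. \<exists>U. open U \<and> u\<^sub>0 \<in> U \<and>
            uniform_limit U
              (\<lambda>\<gamma> u. (\<integral>\<omega>. exp (u * H \<gamma> \<omega>) \<partial>N \<gamma>) / (\<integral>\<omega>. exp (u * X \<gamma> \<omega>) \<partial>M \<gamma>))
              \<Phi> at_top)"
proof -
  have nonneg: "\<Phi> x \<ge> 0" for x using assms(2) by (rule less_imp_le)
  \<comment> \<open>The factor \<open>exp (u^2 * \<gamma>^2 / 2)\<close> is common to
    \<open>penalised_mgf\<close> and \<open>normal_mgf\<close> and cancels. The integrability claims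
    rule out that an integral takes its default value 0.\<close>
  have parts: "integrable (N \<gamma>) (\<lambda>\<omega>. exp (u * H \<gamma> \<omega>)) \<and>
      integrable (M \<gamma>) (\<lambda>\<omega>. exp (u * X \<gamma> \<omega>)) \<and>
      integrable (M \<gamma>) (\<lambda>\<omega>. \<Phi> (X \<gamma> \<omega> / \<gamma>\<^sup>2 + u)) \<and>
      (\<integral>\<omega>. exp (u * H \<gamma> \<omega>) \<partial>N \<gamma>) / (\<integral>\<omega>. exp (u * X \<gamma> \<omega>) \<partial>M \<gamma>) =
      (\<integral>\<omega>. \<Phi> (X \<gamma> \<omega> / \<gamma>\<^sup>2 + u) \<partial>M \<gamma>) / (\<integral>\<omega>. \<Phi> (X \<gamma> \<omega> / \<gamma>\<^sup>2) \<partial>M \<gamma>)"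
    if \<gamma>: "\<gamma> > 0" for \<gamma> u
    using penalised_mgf[OF assms(5)[OF \<gamma>] \<gamma> assms(6)[OF \<gamma>] assms(3) nonneg assms(7)[OF \<gamma>], of u]
      normal_mgf[OF assms(5)[OF \<gamma>] \<gamma> assms(6)[OF \<gamma>], of u]
      normal_expectation_scaled[OF assms(5)[OF \<gamma>] \<gamma> assms(6)[OF \<gamma>] assms(3), of u]
    by (simp add: has_bochner_integral_iff)
  define F where "F = (\<lambda>\<gamma> u. \<integral>y. normal_density u (1 / \<gamma>) y * \<Phi> y \<partial>lborel)"
  have quot: "(\<integral>\<omega>. exp (u * H \<gamma> \<omega>) \<partial>N \<gamma>) / (\<integral>\<omega>. exp (u * X \<gamma> \<omega>) \<partial>M \<gamma>) = F \<gamma> u / F \<gamma> 0"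
    if \<gamma>: "\<gamma> > 0" for \<gamma> u
    using parts[OF \<gamma>, of u]
      normal_expectation_scaled[OF assms(5)[OF \<gamma>] \<gamma> assms(6)[OF \<gamma>] assms(3), of u]
      normal_expectation_scaled[OF assms(5)[OF \<gamma>] \<gamma> assms(6)[OF \<gamma>] assms(3), of 0]
    by (simp add: has_bochner_integral_iff F_def)
  have F: "uniform_limit (cball a r) F \<Phi> at_top" for a r
    unfolding F_def by (rule uniform_limit_normal_smoothing[OF assms(1,3) nonneg])
  \<comment> \<open>The degenerate ball \<open>cball 0 0\<close> is the single point 0, so uniform
    convergence there is convergence of the denominators, to \<open>\<Phi> 0 = 1\<close>.\<close>
  have "((\<lambda>\<gamma>. F \<gamma> 0) \<longlongrightarrow> \<Phi> 0) at_top"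
    using F[of 0 0] by (rule tendsto_uniform_limitI) simp
  then have F0: "uniform_limit S (\<lambda>\<gamma> u. F \<gamma> 0) (\<lambda>u. 1) at_top" for S :: "real set"
    using assms(4) by (auto simp: uniform_limit_iff tendsto_iff elim: eventually_mono)
  have lim: "uniform_limit (ball u\<^sub>0 1)
      (\<lambda>\<gamma> u. (\<integral>\<omega>. exp (u * H \<gamma> \<omega>) \<partial>N \<gamma>) / (\<integral>\<omega>. exp (u * X \<gamma> \<omega>) \<partial>M \<gamma>)) \<Phi> at_top" for u\<^sub>0
  proof -
    \<comment> \<open>Uniform limits may be divided when the limit of the numerators is bounded and
      that of the denominators stays away from 0. The first holds by compactness of the closed ball,
      the second with lower bound \<open>b = 1\<close>.\<close>
    have "bounded (\<Phi> ` cball u\<^sub>0 1)"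
      by (intro compact_imp_bounded compact_continuous_image compact_cball
          continuous_on_subset[OF assms(1)]) simp
    then have "uniform_limit (cball u\<^sub>0 1) (\<lambda>\<gamma> u. F \<gamma> u / F \<gamma> 0) (\<lambda>u. \<Phi> u / 1) at_top"
      by (intro uniform_lim_divide[where b = "1 :: real"] F F0) auto
    from uniform_limit_on_subset[OF this ball_subset_cball]
    have "uniform_limit (ball u\<^sub>0 1) (\<lambda>\<gamma> u. F \<gamma> u / F \<gamma> 0) \<Phi> at_top"
      by simp
    \<comment> \<open>The representation by \<open>F\<close> is available for positive \<gamma>
      only, so the two families agree eventually, which is enough for the limit.\<close>
    moreover have "\<forall>\<^sub>F \<gamma> in at_top. \<forall>u\<in>ball u\<^sub>0 1. F \<gamma> u / F \<gamma> 0 =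
        (\<integral>\<omega>. exp (u * H \<gamma> \<omega>) \<partial>N \<gamma>) / (\<integral>\<omega>. exp (u * X \<gamma> \<omega>) \<partial>M \<gamma>)"
      using eventually_gt_at_top[of 0] by eventually_elim (simp add: quot)
    ultimately show ?thesis by (subst (asm) uniform_limit_cong) auto
  qed
  have "\<exists>U. open U \<and> u\<^sub>0 \<in> U \<and> uniform_limit U
      (\<lambda>\<gamma> u. (\<integral>\<omega>. exp (u * H \<gamma> \<omega>) \<partial>N \<gamma>) / (\<integral>\<omega>. exp (u * X \<gamma> \<omega>) \<partial>M \<gamma>)) \<Phi> at_top" for u\<^sub>0
    using lim[of u\<^sub>0] by (intro exI[of _ "ball u\<^sub>0 1"]) simp
  with parts show ?thesis by blast
qed

end
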